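(* There exists a self-similar, compact set $K \subseteq [0,1]^2$ such that $K$ intersects each line of $\mathbb{R}^2$ that meets $[0,1]^2$, but $K+K$ is nowhere dense in $\mathbb{R}^2$.
   Context: $K+K=\{x+y : x,y\in K\}$. A non-empty compact set $K\subseteq\mathbb{R}^d$ is self-similar if there is a finite family $(\varphi_t)_{t\in T}$ of similarity transformations of $\mathbb{R}^d$, each with similarity ratio in $(0,1)$, such that $K=\bigcup_{t\in T}\varphi_t(K)$. *)

theory Defs
  imports "HOL-Analysis.Analysis"
begin

(* In Euclidean space a map scaling all distances by r > 0 is automatically onto,
   so surjectivity is not required separately. *)
definition is_similarity :: "real \<Rightarrow> ('a::euclidean_space \<Rightarrow> 'a) \<Rightarrow> bool" where
  "is_similarity r f \<longleftrightarrow> r > 0 \<and> (\<forall>x y. dist (f x) (f y) = r * dist x y)"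

(* The finite family is given by its set of members: repeated maps do not affect
   the union, and each map has its own ratio. *)
definition self_similar :: "'a::euclidean_space set \<Rightarrow> bool" where
  "self_similar K \<longleftrightarrow> K \<noteq> {} \<and> compact K \<and>
     (\<exists>\<Phi>. finite \<Phi> \<and> (\<forall>\<phi>\<in>\<Phi>. \<exists>r. 0 < r \<and> r < 1 \<and> is_similarity r \<phi>) \<and>
          K = (\<Union>\<phi>\<in>\<Phi>. \<phi> ` K))"

definition nowhere_dense :: "'a::topological_space set \<Rightarrow> bool" where
  "nowhere_dense S \<longleftrightarrow> interior (closure S) = {}"

definition is_line :: "'a::euclidean_space set \<Rightarrow> bool" where
  "is_line L \<longleftrightarrow> affine L \<and> aff_dim L = 1"

end

theory Submission
  imports Defs
begin

text \<open>
  Put \<open>n = b\<^sup>3\<close> and let \<open>K\<close> be the attractor of the maps \<open>x \<mapsto> (x + a) / n\<close> for \<open>a\<close> in a set \<open>A\<close> of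
  cells of the \<open>n \<times> n\<close> grid. If every line meeting the square \<open>[0, n]\<^sup>2\<close> meets a cell of \<open>A\<close>, then by
  self-similarity and compactness every line meeting the unit square meets \<open>K\<close>. On the other hand
  \<open>K + K\<close> is covered by \<open>|A + A|\<close> copies of itself scaled by \<open>1 / n\<close>, so it is a null set once
  \<open>|A + A| < n\<^sup>2\<close>.

  About \<open>n\<close> cells suffice to block the lines of a sector of directions, and then two unrelated
  blocking sets would have about \<open>n\<^sup>2\<close> sums. So all parts of \<open>A\<close> are taken from generalised arithmetic
  progressions with the same four steps \<open>(1, 1)\<close>, \<open>(0, b)\<close>, \<open>(b\<^sup>2, 0)\<close>, \<open>(1, 0)\<close>, in such a way that any
  two parts share a long step and have only \<open>O(b\<^sup>5)\<close> sums, while each of the directions parallel to a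
  step is blocked by a part that does not rely on that step.
\<close>

subsection \<open>Attractors meeting prescribed closed sets\<close>

text \<open>Iterating the union of the maps from \<open>Q\<close> gives decreasing compact sets with
  intersection \<open>K\<close>. By \<open>block\<close>, a set of the family that meets
  \<open>Q\<close> pulls back to another such set, hence meets every iterate, and compactness gives
  a point in \<open>K\<close>.\<close>

lemma attractor_exists:
  fixes Q :: "'a::heine_borel set" and \<Phi> :: "('a \<Rightarrow> 'a) set" and \<L> :: "'a set set"
  assumes Q: "compact Q" and fin: "finite \<Phi>"
    and maps: "\<And>\<phi>. \<phi> \<in> \<Phi> \<Longrightarrow> continuous_on UNIV \<phi> \<and> inj \<phi> \<and> \<phi> ` Q \<subseteq> Q"
    and closed: "\<And>L. L \<in> \<L> \<Longrightarrow> closed L"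
    and block: "\<And>L. L \<in> \<L> \<Longrightarrow> L \<inter> Q \<noteq> {} \<Longrightarrow> \<exists>\<phi>\<in>\<Phi>. \<phi> -` L \<in> \<L> \<and> (\<phi> -` L) \<inter> Q \<noteq> {}"
  obtains K where "compact K" "K \<subseteq> Q" "K = (\<Union>\<phi>\<in>\<Phi>. \<phi> ` K)"
    "\<And>L. L \<in> \<L> \<Longrightarrow> L \<inter> Q \<noteq> {} \<Longrightarrow> L \<inter> K \<noteq> {}"
proof -
  define F where "F X = (\<Union>\<phi>\<in>\<Phi>. \<phi> ` X)" for X
  define X where "X k = (F ^^ k) Q" for k
  have X0: "X 0 = Q" and XS: "X (Suc k) = F (X k)" for k
    by (simp_all add: X_def)
  have mono: "F S \<subseteq> F T" if "S \<subseteq> T" for S T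
    using that by (auto simp: F_def)
  have step: "X (Suc k) \<subseteq> X k" for k
  proof (induction k)
    case 0
    show ?case using maps by (auto simp: X0 XS F_def)
  next
    case (Suc k)
    show ?case using mono[OF Suc] by (simp add: XS)
  qed
  have dec: "X m \<subseteq> X k" if "k \<le> m" for k m
    using lift_Suc_antimono_le[of X, OF step that] .
  have comp: "compact (X k)" for k
  proof (induction k)
    case 0
    show ?case using Q by (simp add: X0)
  next
    case (Suc k)
    show ?case unfolding XS F_def
      using fin maps by (intro compact_UN compact_continuous_image Suc)
        (auto intro: continuous_on_subset)
  qed
  define K where "K = (\<Inter>k. X k)"
  have "F K \<subseteq> K"
  proof -
    have "F K \<subseteq> X (Suc k)" for k
      unfolding XS by (rule mono) (auto simp: K_def)
    then show ?thesis
      using step by (fastforce simp: K_def)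
  qed
  moreover have "K \<subseteq> F K"
  proof
    fix x assume x: "x \<in> K"
    have "\<exists>\<phi>\<in>\<Phi>. x \<in> \<phi> ` X k" for k
    proof -
      have "x \<in> X (Suc k)" using x by (auto simp: K_def)
      then show ?thesis by (auto simp: XS F_def)
    qed
    then obtain f where f: "\<And>k. f k \<in> \<Phi>" "\<And>k. x \<in> f k ` X k"
      by metis
    \<comment> \<open>The chosen map may vary with \<open>k\<close>, but one of the finitely many
      recurs infinitely often. By injectivity its preimage of \<open>x\<close> is the same each
      time, so it lies in every \<open>X k\<close>.\<close>
    have "\<exists>k0\<in>UNIV. infinite {k \<in> UNIV. f k = f k0}"
      by (rule pigeonhole_infinite) (use fin f(1) in \<open>auto intro: finite_subset[of _ \<Phi>]\<close>)
    then obtain k0 where inf: "infinite {k. f k = f k0}" by auto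
    obtain y where y: "x = f k0 y" using f(2)[of k0] by auto
    have "y \<in> X k" for k
    proof -
      obtain m where m: "m > k" "f m = f k0"
        using inf by (auto simp: infinite_nat_iff_unbounded)
      then obtain z where z: "z \<in> X m" "x = f k0 z" using f(2)[of m] by auto
      have "z = y" using y z maps[OF f(1)[of k0]] by (auto dest: injD)
      then show ?thesis using z dec[of k m] m by auto
    qed
    then show "x \<in> F K" using y f(1) by (auto simp: F_def K_def)
  qed
  ultimately have K_eq: "K = F K" by blast
  have "closed K"
    unfolding K_def using comp by (intro closed_INT ballI compact_imp_closed)
  then have K_comp: "compact K"
    using compact_Int_closed[OF Q, of K] X0 by (simp add: Int_absorb1 K_def INF_lower2[of 0])
  have meet: "L \<inter> X k \<noteq> {}" if "L \<in> \<L>" "L \<inter> Q \<noteq> {}" for L k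
    using that
  proof (induction k arbitrary: L)
    case 0
    then show ?case by (simp add: X0)
  next
    case (Suc k)
    obtain \<phi> where \<phi>: "\<phi> \<in> \<Phi>" "\<phi> -` L \<in> \<L>" "(\<phi> -` L) \<inter> Q \<noteq> {}"
      using block[OF Suc.prems] by auto
    obtain z where "z \<in> X k" "\<phi> z \<in> L"
      using Suc.IH[OF \<phi>(2,3)] by blast
    moreover have "\<phi> z \<in> X (Suc k)"
      unfolding XS F_def using \<phi>(1) \<open>z \<in> X k\<close> by blast
    ultimately show ?case by blast
  qed
  have "L \<inter> K \<noteq> {}" if L: "L \<in> \<L>" "L \<inter> Q \<noteq> {}" for L
  proof -
    have "\<Inter>(range (\<lambda>k. L \<inter> X k)) \<noteq> {}"
    proof (rule compact_nest)
      show "compact (L \<inter> X k)" "L \<inter> X k \<noteq> {}" for k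
        using closed_Int_compact[OF closed[OF L(1)] comp[of k]] meet[OF L] by blast+
    qed (use dec in blast)
    then show ?thesis by (auto simp: K_def)
  qed
  then show thesis
    using that[OF K_comp] K_eq X0 by (auto simp: F_def K_def)
qed

text \<open>The pieces have total measure at most a factor below 1 times that of \<open>E\<close>,
  so the compact set \<open>E\<close> is null; it is closed and has empty interior.\<close>

lemma nowhere_dense_if_few_pieces:
  fixes E :: "'a::euclidean_space set" and D :: "'a set"
  assumes E: "compact E" and D: "finite D" and r: "r \<ge> 0"
    and few: "real (card D) * r ^ DIM('a) < 1"
    and cover: "E \<subseteq> (\<Union>d\<in>D. (\<lambda>x. r *\<^sub>R x + d) ` E)"
  shows "nowhere_dense E"
proof -
  have comp: "compact ((\<lambda>x. r *\<^sub>R x + d) ` E)" for d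
    using E by (intro compact_continuous_image continuous_intros)
  have lm: "S \<in> lmeasurable" if "compact S" for S :: "'a set"
    using that by (rule lmeasurable_compact)
  have "measure lebesgue E \<le> measure lebesgue (\<Union>d\<in>D. (\<lambda>x. r *\<^sub>R x + d) ` E)"
    using cover D comp E by (intro measure_mono_fmeasurable lm fmeasurableD compact_UN) auto
  also have "\<dots> \<le> (\<Sum>d\<in>D. measure lebesgue ((\<lambda>x. r *\<^sub>R x + d) ` E))"
    using D comp by (intro measure_UNION_le fmeasurableD lm) auto
  also have "\<dots> = real (card D) * r ^ DIM('a) * measure lebesgue E"
    using r by (simp add: measure_lebesgue_affine)
  finally have "measure lebesgue E * (1 - real (card D) * r ^ DIM('a)) \<le> 0"
    by (simp add: algebra_simps)
  then have "measure lebesgue E = 0"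
    using few measure_nonneg[of lebesgue E]
    by (smt (verit, best) mult_pos_pos)
  then have "negligible E"
    using lm[OF E] by (simp add: negligible_iff_measure0)
  then have "interior E = {}"
    by (meson interior_subset negligible_subset open_interior open_not_negligible)
  then show ?thesis
    using E by (simp add: nowhere_dense_def compact_imp_closed closure_closed)
qed

subsection \<open>A grid set with few sums\<close>

text \<open>The parameters bound the multiples of the steps \<open>(1, 1)\<close>,
  \<open>(0, b)\<close>, \<open>(b\<^sup>2, 0)\<close>, \<open>(1, 0)\<close>, in this order.
  Symmetric ranges make the set closed under negation and let parameters add under sums.\<close>

definition gap :: "int \<Rightarrow> int \<times> int \<times> int \<times> int \<Rightarrow> (int \<times> int) set" where
  "gap b = (\<lambda>(\<alpha>, \<beta>, \<gamma>, \<delta>). (\<lambda>(i, j, l, m). (i + b\<^sup>2 * l + m, i + b * j)) `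
     ({-\<alpha>..\<alpha>} \<times> {-\<beta>..\<beta>} \<times> {-\<gamma>..\<gamma>} \<times> {-\<delta>..\<delta>}))"

text \<open>
  The first type is a pile of diagonal segments along a vertical edge of the square and blocks the
  slopes in \<open>[-1, 1/2]\<close>; the second is a row of longer diagonal segments along a horizontal edge and
  does the same with the coordinates exchanged; the third is a thick row of horizontal segments
  blocking the slopes in \<open>[1/2, 2]\<close>; the fourth fills the gaps left at the ends of these strips.
\<close>

definition gap_types :: "int \<Rightarrow> (int \<times> int \<times> int \<times> int) set" where
  "gap_types b = {(2 * b, b\<^sup>2, 0, 0), (2 * b\<^sup>2, 0, b, 0), (0, 2 * b, b, 2 * b), (2 * b, 0, 0, 2 * b\<^sup>2)}"

text \<open>
  The two middle heights are exchanged by the reflection of the grid in its centre, which therefore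
  preserves the set of digits when \<open>b\<close> is even.
\<close>

definition origins :: "int \<Rightarrow> (int \<times> int) set" where
  "origins b = {0, b ^ 3 - 1} \<times> {0, b ^ 3 div 2 - 1, b ^ 3 div 2, b ^ 3 - 1}"

text \<open>Placing every type at every origin costs only a constant factor in the number of sums.
  As the ranges are two-sided, cutting with the grid leaves strips running inward from each
  origin.\<close>

definition digits :: "int \<Rightarrow> (int \<times> int) set" where
  "digits b = (origins b + (\<Union>v\<in>gap_types b. gap b v)) \<inter> ({0..<b ^ 3} \<times> {0..<b ^ 3})"

section \<open>Arithmetic and size of the progressions\<close>

lemma gapI:
  assumes "\<bar>i\<bar> \<le> \<alpha>" "\<bar>j\<bar> \<le> \<beta>" "\<bar>l\<bar> \<le> \<gamma>" "\<bar>m\<bar> \<le> \<delta>"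
    and "p = (i + b\<^sup>2 * l + m, i + b * j)"
  shows "p \<in> gap b (\<alpha>, \<beta>, \<gamma>, \<delta>)"
  unfolding gap_def using assms by (force intro!: rev_image_eqI[of "(i, j, l, m)"])

lemma gapE:
  assumes "p \<in> gap b (\<alpha>, \<beta>, \<gamma>, \<delta>)"
  obtains i j l m where "\<bar>i\<bar> \<le> \<alpha>" "\<bar>j\<bar> \<le> \<beta>" "\<bar>l\<bar> \<le> \<gamma>" "\<bar>m\<bar> \<le> \<delta>"
    "p = (i + b\<^sup>2 * l + m, i + b * j)"
  using assms by (fastforce simp: gap_def abs_le_iff)

lemma gap_uminus: "p \<in> gap b v \<Longrightarrow> - p \<in> gap b v"
proof -
  assume p: "p \<in> gap b v"
  obtain \<alpha> \<beta> \<gamma> \<delta> where v: "v = (\<alpha>, \<beta>, \<gamma>, \<delta>)" by (cases v)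
  from p[unfolded v] obtain i j l m where "\<bar>i\<bar> \<le> \<alpha>" "\<bar>j\<bar> \<le> \<beta>" "\<bar>l\<bar> \<le> \<gamma>" "\<bar>m\<bar> \<le> \<delta>"
    "p = (i + b\<^sup>2 * l + m, i + b * j)" by (rule gapE)
  then show ?thesis
    unfolding v by (intro gapI[of "- i" _ "- j" _ "- l" _ "- m"]) auto
qed

lemma gap_add: "gap b v + gap b w \<subseteq> gap b (v + w)"
proof
  fix r assume "r \<in> gap b v + gap b w"
  then obtain p q where pq: "p \<in> gap b v" "q \<in> gap b w" "r = p + q" by (rule set_plus_elim)
  obtain \<alpha> \<beta> \<gamma> \<delta> where v: "v = (\<alpha>, \<beta>, \<gamma>, \<delta>)" by (cases v)
  obtain \<alpha>' \<beta>' \<gamma>' \<delta>' where w: "w = (\<alpha>', \<beta>', \<gamma>', \<delta>')" by (cases w)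
  obtain i j l m where p: "\<bar>i\<bar> \<le> \<alpha>" "\<bar>j\<bar> \<le> \<beta>" "\<bar>l\<bar> \<le> \<gamma>" "\<bar>m\<bar> \<le> \<delta>"
    "p = (i + b\<^sup>2 * l + m, i + b * j)" using pq(1)[unfolded v] by (rule gapE)
  obtain i' j' l' m' where q: "\<bar>i'\<bar> \<le> \<alpha>'" "\<bar>j'\<bar> \<le> \<beta>'" "\<bar>l'\<bar> \<le> \<gamma>'" "\<bar>m'\<bar> \<le> \<delta>'"
    "q = (i' + b\<^sup>2 * l' + m', i' + b * j')" using pq(2)[unfolded w] by (rule gapE)
  have vw: "v + w = (\<alpha> + \<alpha>', \<beta> + \<beta>', \<gamma> + \<gamma>', \<delta> + \<delta>')"
    by (simp add: v w)
  show "r \<in> gap b (v + w)"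
    unfolding vw
  proof (rule gapI)
    show "\<bar>i + i'\<bar> \<le> \<alpha> + \<alpha>'" "\<bar>j + j'\<bar> \<le> \<beta> + \<beta>'" "\<bar>l + l'\<bar> \<le> \<gamma> + \<gamma>'" "\<bar>m + m'\<bar> \<le> \<delta> + \<delta>'"
      using p(1-4) q(1-4) abs_triangle_ineq[of i i'] abs_triangle_ineq[of j j']
        abs_triangle_ineq[of l l'] abs_triangle_ineq[of m m']
      by (meson add_mono order_trans)+
    show "r = ((i + i') + b\<^sup>2 * (l + l') + (m + m'), (i + i') + b * (j + j'))"
      using pq(3) p(5) q(5) by (simp add: algebra_simps)
  qed
qed

lemma finite_gap: "finite (gap b v)"
  by (cases v) (simp add: gap_def)

lemma card_gap_le:
  assumes "\<alpha> \<ge> 0" "\<beta> \<ge> 0" "\<gamma> \<ge> 0" "\<delta> \<ge> 0"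
  shows "int (card (gap b (\<alpha>, \<beta>, \<gamma>, \<delta>))) \<le>
    (2 * \<alpha> + 1) * ((2 * \<beta> + 1) * ((2 * \<gamma> + 1) * (2 * \<delta> + 1)))"
proof -
  have "card (gap b (\<alpha>, \<beta>, \<gamma>, \<delta>)) \<le>
      card ({-\<alpha>..\<alpha>} \<times> {-\<beta>..\<beta>} \<times> {-\<gamma>..\<gamma>} \<times> {-\<delta>..\<delta>})"
    unfolding gap_def prod.case by (rule card_image_le) auto
  then have "int (card (gap b (\<alpha>, \<beta>, \<gamma>, \<delta>))) \<le>
      int (card ({-\<alpha>..\<alpha>} \<times> {-\<beta>..\<beta>} \<times> {-\<gamma>..\<gamma>} \<times> {-\<delta>..\<delta>}))"
    by linarith
  then show ?thesis
    using assms by (simp add: card_cartesian_product)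
qed

text \<open>For any two types, the product of the combined ranges has degree at most 5 in
  \<open>b\<close>, whereas the grid has \<open>b ^ 6\<close> cells.\<close>

lemma card_gap_types_add:
  assumes b: "b \<ge> 1" and v: "v \<in> gap_types b" and w: "w \<in> gap_types b"
  shows "int (card (gap b (v + w))) \<le> 1000 * b ^ 5"
proof -
  \<comment> \<open>Each expanded product is at most its coefficient sum times \<open>q\<close>; the
    largest such sum is 675, for \<open>(2 * b, 2 * b, b, 2 * b + 2 * b\<^sup>2)\<close>.\<close>
  define q where "q = b ^ 5"
  have pw: "1 \<le> q" "b \<le> q" "b * b \<le> q" "b * (b * b) \<le> q" "b * (b * (b * b)) \<le> q"
    "b * (b * (b * (b * b))) = q"
    using b power_increasing[of 0 5 b] power_increasing[of 1 5 b] power_increasing[of 2 5 b]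
      power_increasing[of 3 5 b] power_increasing[of 4 5 b]
    by (simp_all add: q_def eval_nat_numeral)
  have b0: "b \<ge> 0" using b by simp
  obtain \<alpha> \<beta> \<gamma> \<delta> where vw: "v + w = (\<alpha>, \<beta>, \<gamma>, \<delta>)" by (cases "v + w")
  have nn: "\<alpha> \<ge> 0" "\<beta> \<ge> 0" "\<gamma> \<ge> 0" "\<delta> \<ge> 0"
    using v w vw b0 by (auto simp: gap_types_def)
  consider
      "(\<alpha>, \<beta>, \<gamma>, \<delta>) = (4 * b, 2 * b\<^sup>2, 0, 0)"
    | "(\<alpha>, \<beta>, \<gamma>, \<delta>) = (2 * b + 2 * b\<^sup>2, b\<^sup>2, b, 0)"
    | "(\<alpha>, \<beta>, \<gamma>, \<delta>) = (2 * b, b\<^sup>2 + 2 * b, b, 2 * b)"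
    | "(\<alpha>, \<beta>, \<gamma>, \<delta>) = (4 * b, b\<^sup>2, 0, 2 * b\<^sup>2)"
    | "(\<alpha>, \<beta>, \<gamma>, \<delta>) = (4 * b\<^sup>2, 0, 2 * b, 0)"
    | "(\<alpha>, \<beta>, \<gamma>, \<delta>) = (2 * b\<^sup>2, 2 * b, 2 * b, 2 * b)"
    | "(\<alpha>, \<beta>, \<gamma>, \<delta>) = (2 * b + 2 * b\<^sup>2, 0, b, 2 * b\<^sup>2)"
    | "(\<alpha>, \<beta>, \<gamma>, \<delta>) = (0, 4 * b, 2 * b, 4 * b)"
    | "(\<alpha>, \<beta>, \<gamma>, \<delta>) = (2 * b, 2 * b, b, 2 * b + 2 * b\<^sup>2)"
    | "(\<alpha>, \<beta>, \<gamma>, \<delta>) = (4 * b, 0, 0, 4 * b\<^sup>2)"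
    using v w unfolding vw[symmetric] gap_types_def
    by (elim insertE emptyE) (simp_all add: add.commute)
  then have "(2 * \<alpha> + 1) * ((2 * \<beta> + 1) * ((2 * \<gamma> + 1) * (2 * \<delta> + 1))) \<le> 1000 * q"
    by cases (simp_all add: algebra_simps power2_eq_square, (use pw in linarith)+)
  then show ?thesis
    using card_gap_le[OF nn, of b] vw by (simp add: q_def)
qed

section \<open>Membership, central symmetry and sums of the digit set\<close>

lemma digitsI:
  assumes "(c, d) \<in> origins b" "(\<alpha>, \<beta>, \<gamma>, \<delta>) \<in> gap_types b"
    and "\<bar>i\<bar> \<le> \<alpha>" "\<bar>j\<bar> \<le> \<beta>" "\<bar>l\<bar> \<le> \<gamma>" "\<bar>m\<bar> \<le> \<delta>"
    and "x = c + (i + b\<^sup>2 * l + m)" "y = d + (i + b * j)"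
    and "0 \<le> x" "x < b ^ 3" "0 \<le> y" "y < b ^ 3"
  shows "(x, y) \<in> digits b"
proof -
  have "(i + b\<^sup>2 * l + m, i + b * j) \<in> (\<Union>v\<in>gap_types b. gap b v)"
    using gapI[OF assms(3-6) refl, of b] assms(2) by blast
  then have "(c, d) + (i + b\<^sup>2 * l + m, i + b * j) \<in> origins b + (\<Union>v\<in>gap_types b. gap b v)"
    using assms(1) by (rule set_plus_intro[rotated])
  then show ?thesis
    using assms(7-) by (simp add: digits_def)
qed

text \<open>The reflection turns \<open>u + p\<close> into the reflection of \<open>u\<close> plus
  \<open>- p\<close>: the progressions are symmetric, and for even \<open>b\<close> the heights in
  \<open>origins b\<close> are permuted.\<close>

lemma digits_reflect:
  assumes "even b" and xy: "(x, y) \<in> digits b"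
  shows "(b ^ 3 - 1 - x, b ^ 3 - 1 - y) \<in> digits b"
proof -
  have mem: "(x, y) \<in> origins b + (\<Union>v\<in>gap_types b. gap b v)"
    and box: "(x, y) \<in> {0..<b ^ 3} \<times> {0..<b ^ 3}"
    using xy unfolding digits_def by simp_all
  obtain u p where u: "u \<in> origins b" and p': "p \<in> (\<Union>v\<in>gap_types b. gap b v)"
    and xy_eq: "(x, y) = u + p"
    using mem unfolding set_plus_def by blast
  then obtain v where v: "v \<in> gap_types b" and p: "p \<in> gap b v" by blast
  obtain c d where u': "u = (c, d)" by (cases u)
  have "even (b ^ 3)" using \<open>even b\<close> by simp
  then obtain h where h: "b ^ 3 = 2 * h" by (rule evenE)
  have "(b ^ 3 - 1 - c, b ^ 3 - 1 - d) \<in> origins b"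
    using u unfolding u' origins_def h by auto
  then have "(b ^ 3 - 1 - c, b ^ 3 - 1 - d) + - p \<in> origins b + (\<Union>v\<in>gap_types b. gap b v)"
    using gap_uminus[OF p] v by (intro set_plus_intro) auto
  moreover have "(b ^ 3 - 1 - c, b ^ 3 - 1 - d) + - p = (b ^ 3 - 1 - x, b ^ 3 - 1 - y)"
    using xy_eq by (cases p) (simp add: u')
  ultimately show ?thesis
    using box by (auto simp: digits_def)
qed

lemma finite_digits: "finite (digits b)"
  by (simp add: digits_def)

text \<open>The constant is 64 * 16 * 1000: at most 8 * 8 sums of origins, 4 * 4 pairs of types, and
  the bound for each pair.\<close>

lemma card_digits_add_le:
  assumes b: "b \<ge> 1"
  shows "int (card (digits b + digits b)) \<le> 1024000 * b ^ 5"
proof -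
  define G where "G = (\<Union>(v, w)\<in>gap_types b \<times> gap_types b. gap b (v + w))"
  have fin: "finite (gap_types b)" "finite (origins b)" "finite G"
    by (auto simp: gap_types_def origins_def G_def finite_gap)
  have card_types: "card (gap_types b) \<le> 4"
    unfolding gap_types_def by (simp add: card_insert_if)
  have "card (origins b) = card {0, b ^ 3 - 1} * card {0, b ^ 3 div 2 - 1, b ^ 3 div 2, b ^ 3 - 1}"
    unfolding origins_def by (rule card_cartesian_product)
  also have "\<dots> \<le> 2 * 4"
    by (intro mult_mono) (simp_all add: card_insert_if)
  finally have card_origins: "card (origins b) \<le> 8" by simp
  have sub: "digits b + digits b \<subseteq> (origins b + origins b) + G"
  proof -
    define W where "W = (\<Union>v\<in>gap_types b. gap b v)"
    have "digits b + digits b \<subseteq> (origins b + W) + (origins b + W)"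
      by (intro set_plus_mono2) (auto simp: digits_def W_def)
    also have "\<dots> = (origins b + origins b) + (W + W)"
      by (simp add: ac_simps)
    also have "W + W \<subseteq> G"
    proof
      fix x assume "x \<in> W + W"
      then obtain p q where "p \<in> W" "q \<in> W" "x = p + q"
        unfolding set_plus_def by blast
      then obtain v w where "v \<in> gap_types b" "w \<in> gap_types b" "x \<in> gap b v + gap b w"
        unfolding W_def by (blast intro: set_plus_intro)
      then show "x \<in> G"
        using gap_add[of b v w] unfolding G_def by blast
    qed
    then have "(origins b + origins b) + (W + W) \<subseteq> (origins b + origins b) + G"
      by (intro set_plus_mono2) auto
    finally show ?thesis .
  qed
  have card_plus: "card (A + B) \<le> card A * card B" if "finite A" "finite B"
    for A B :: "(int \<times> int) set"
    using card_image_le[of "A \<times> B" "\<lambda>(x, y). x + y"] that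
    by (simp add: set_plus_image card_cartesian_product)
  have "card (digits b + digits b) \<le> card ((origins b + origins b) + G)"
    using sub fin by (intro card_mono finite_set_plus)
  also have "\<dots> \<le> card (origins b + origins b) * card G"
    using fin by (intro card_plus finite_set_plus)
  also have "\<dots> \<le> 64 * card G"
  proof (rule mult_right_mono)
    have "card (origins b + origins b) \<le> card (origins b) * card (origins b)"
      using fin by (intro card_plus)
    also have "\<dots> \<le> 8 * 8"
      by (intro mult_mono card_origins) auto
    finally show "card (origins b + origins b) \<le> 64" by simp
  qed simp
  finally have 1: "int (card (digits b + digits b)) \<le> 64 * int (card G)" by linarith
  have "card G \<le> (\<Sum>(v, w)\<in>gap_types b \<times> gap_types b. card (gap b (v + w)))"
    unfolding G_def using card_UN_le[of "gap_types b \<times> gap_types b" "\<lambda>(v, w). gap b (v + w)"] fin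
    by (simp add: case_prod_unfold)
  then have "int (card G) \<le> (\<Sum>(v, w)\<in>gap_types b \<times> gap_types b. int (card (gap b (v + w))))"
    by (simp add: case_prod_unfold flip: of_nat_sum)
  also have "\<dots> \<le> (\<Sum>(v, w)\<in>gap_types b \<times> gap_types b. 1000 * b ^ 5)"
    using card_gap_types_add[OF b] by (intro sum_mono) auto
  also have "\<dots> = int (card (gap_types b) * card (gap_types b)) * (1000 * b ^ 5)"
    by (simp add: case_prod_unfold card_cartesian_product)
  also have "\<dots> \<le> int (4 * 4) * (1000 * b ^ 5)"
    using b by (intro mult_right_mono of_nat_mono mult_mono card_types) auto
  finally show ?thesis using 1 by simp
qed

subsection \<open>Blocking lines\<close>

text \<open>The implicit equation treats vertical lines like all others. Coordinates are those of
  the grid: the digit \<open>(i, j)\<close> stands for the closed unit cell with that lower left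
  corner.\<close>

definition line_hits :: "int \<Rightarrow> real \<Rightarrow> real \<Rightarrow> real \<Rightarrow> bool" where
  "line_hits b \<alpha> \<beta> \<gamma> \<longleftrightarrow> (\<exists>(i, j)\<in>digits b. \<exists>x\<in>{of_int i..of_int i + 1}.
     \<exists>y\<in>{of_int j..of_int j + 1}. \<alpha> * x + \<beta> * y = \<gamma>)"

lemma line_hitsI:
  assumes "(i, j) \<in> digits b" "of_int i \<le> x" "x \<le> of_int i + 1" "of_int j \<le> y" "y \<le> of_int j + 1"
    "\<alpha> * x + \<beta> * y = \<gamma>"
  shows "line_hits b \<alpha> \<beta> \<gamma>"
  unfolding line_hits_def using assms by force

lemma line_hitsE:
  assumes "line_hits b \<alpha> \<beta> \<gamma>"
  obtains i j x y where "(i, j) \<in> digits b" "of_int i \<le> x" "x \<le> of_int i + 1"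
    "of_int j \<le> y" "y \<le> of_int j + 1" "\<alpha> * x + \<beta> * y = \<gamma>"
  using assms by (force simp: line_hits_def)

lemma line_hits_reflect:
  assumes "even b" and "line_hits b \<alpha> \<beta> (of_int b ^ 3 * (\<alpha> + \<beta>) - \<gamma>)"
  shows "line_hits b \<alpha> \<beta> \<gamma>"
  using assms(2)
proof (rule line_hitsE)
  fix i j x y
  assume *: "(i, j) \<in> digits b" "of_int i \<le> x" "x \<le> of_int i + 1" "of_int j \<le> y" "y \<le> of_int j + 1"
    "\<alpha> * x + \<beta> * y = of_int b ^ 3 * (\<alpha> + \<beta>) - \<gamma>"
  have "\<alpha> * (of_int b ^ 3 - x) + \<beta> * (of_int b ^ 3 - y) = \<gamma>"
    using *(6) by (simp add: algebra_simps)
  then show ?thesis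
    using *(2-5) by (intro line_hitsI[OF digits_reflect[OF assms(1) *(1)]]) auto
qed

lemma line_hits_scale:
  assumes "line_hits b (c * \<alpha>) (c * \<beta>) (c * \<gamma>)" "c \<noteq> 0"
  shows "line_hits b \<alpha> \<beta> \<gamma>"
  using assms(1)
proof (rule line_hitsE)
  fix i j x y
  assume *: "(i, j) \<in> digits b" "of_int i \<le> x" "x \<le> of_int i + 1" "of_int j \<le> y" "y \<le> of_int j + 1"
    "c * \<alpha> * x + c * \<beta> * y = c * \<gamma>"
  have "c * (\<alpha> * x + \<beta> * y) = c * \<gamma>"
    using *(6) by (simp add: algebra_simps)
  then show ?thesis
    using *(2-5) assms(2) by (intro line_hitsI[OF *(1)]) auto
qed

text \<open>Diagonals start on the left edge at the multiples of \<open>B\<close>. Above the last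
  one starting at or below \<open>t\<close>, the line has height \<open>r - (1 - s) * x\<close> with
  \<open>0 \<le> r < B\<close>; as \<open>1 - s\<close> is at least 1/2, it comes down to the
  diagonal before \<open>x = 2 * B\<close>.\<close>

lemma zigzag:
  fixes s t :: real and B :: int
  assumes s: "- 1 \<le> s" "s \<le> 1 / 2" and t: "0 \<le> t" and B: "B > 0"
  obtains i j :: int and x :: real where "0 \<le> i" "i < 2 * B" "0 \<le> j" "of_int (B * j) \<le> t"
    "of_int i \<le> x" "x \<le> of_int i + 1"
    "of_int (B * j + i) \<le> s * x + t" "s * x + t \<le> of_int (B * j + i) + 1"
proof -
  define j where "j = \<lfloor>t / of_int B\<rfloor>"
  define r where "r = t - of_int B * of_int j"
  have "of_int j \<le> t / of_int B" "t / of_int B < of_int j + 1"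
    unfolding j_def by linarith+
  then have r: "0 \<le> r" "r < of_int B"
    using B by (simp_all add: r_def field_simps)
  have "0 \<le> j" using t B by (simp add: j_def)
  define i where "i = \<lfloor>r / (1 - s)\<rfloor>"
  define e where "e = r - of_int i * (1 - s)"
  have "of_int i \<le> r / (1 - s)" "r / (1 - s) < of_int i + 1"
    unfolding i_def by linarith+
  then have e: "0 \<le> e" "e < 1 - s"
    using s by (simp_all add: e_def field_simps)
  have "0 \<le> i" using r s by (simp add: i_def)
  have "of_int i * (1 / 2) \<le> of_int i * (1 - s)"
    using s \<open>0 \<le> i\<close> by (intro mult_left_mono) auto
  then have "of_int i < 2 * (of_int B :: real)"
    using e r by (simp add: e_def)
  then have "i < 2 * B" by linarith
  have val: "s * of_int i + t = of_int (B * j + i) + e"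
    by (simp add: e_def r_def algebra_simps)
  show thesis
  \<comment> \<open>If \<open>e > 1\<close>, the line passes above the upper left corner of the
    cell, but \<open>e + s\<close> lies between 0 and 1, so the line meets the right edge.\<close>
  proof (cases "e \<le> 1")
    case True
    show thesis
      by (rule that[of i j "of_int i"])
        (use \<open>0 \<le> i\<close> \<open>i < 2 * B\<close> \<open>0 \<le> j\<close> val e r True in \<open>auto simp: r_def\<close>)
  next
    case False
    have "s * (of_int i + 1) + t = of_int (B * j + i) + (e + s)"
      using val by (simp add: algebra_simps)
    then show thesis
      by (intro that[of i j "of_int i + 1"])
        (use \<open>0 \<le> i\<close> \<open>i < 2 * B\<close> \<open>0 \<le> j\<close> e r s False in \<open>auto simp: r_def\<close>)
  qed
qed

lemma unit_interval_below:
  fixes t :: real and n k :: int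
  assumes "of_int (n - k) < t" "t \<le> of_int n"
  obtains j where "of_int j \<le> t" "t \<le> of_int j + 1" "n - k \<le> j" "j \<le> n - 1"
\<comment> \<open>The ceiling minus 1, unlike the floor, stays below \<open>n\<close> when
  \<open>t = n\<close>.\<close>
proof (rule that[of "\<lceil>t\<rceil> - 1"])
  show "n - k \<le> \<lceil>t\<rceil> - 1" "\<lceil>t\<rceil> - 1 \<le> n - 1"
    using assms by linarith+
qed linarith+

text \<open>A line of slope at most 1 in absolute value that meets the square crosses its left or
  its right edge; \<open>N - s * N - t\<close> is the intercept after reflecting the square in its
  centre.\<close>

lemma slope_cases:
  fixes s t N x y :: real
  assumes s: "- 1 \<le> s" "s \<le> 1" and xy: "0 \<le> x" "x \<le> N" "0 \<le> y" "y \<le> N" and eq: "y = s * x + t"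
  shows "(0 \<le> t \<and> t \<le> N) \<or> (0 \<le> N - s * N - t \<and> N - s * N - t \<le> N)"
proof (cases "s \<ge> 0")
  case True
  have "s * x \<le> s * N" "0 \<le> s * x" "s * N \<le> N"
    using s xy True mult_right_mono[of s 1 N] by (simp_all add: mult_left_mono)
  then show ?thesis using eq xy by linarith
next
  case False
  have "s * N \<le> s * x" "s * x \<le> 0" "- N \<le> s * N"
    using s xy False mult_right_mono[of "- 1" s N]
    by (simp_all add: mult_left_mono_neg mult_nonpos_nonneg)
  then show ?thesis using eq xy by linarith
qed

section \<open>Blocking lines by the individual strips\<close>

context
  fixes b :: int
  assumes b: "b \<ge> 6" "even b"
begin

text \<open>The bound \<open>6 * b\<^sup>2 \<le> b ^ 3\<close> leaves room below the middle height
  for a row of depth \<open>2 * b\<^sup>2\<close>.\<close>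

lemma powers: "2 * b \<le> b\<^sup>2" "4 * b \<le> b ^ 3" "6 * b\<^sup>2 \<le> b ^ 3" "b \<le> b\<^sup>2" "b * b\<^sup>2 = b ^ 3"
proof -
  show 1: "2 * b \<le> b\<^sup>2" "b \<le> b\<^sup>2" and 2: "b * b\<^sup>2 = b ^ 3"
    using b by (simp_all add: power2_eq_square power3_eq_cube)
  show "6 * b\<^sup>2 \<le> b ^ 3"
    using mult_right_mono[OF b(1), of "b\<^sup>2"] 2 by simp
  then show "4 * b \<le> b ^ 3"
    using 1 b by linarith
qed

text \<open>Here and below, the case distinction separates the short end of the edge where the strip does
  not fit into the square.\<close>

lemma hits_left_edge:
  assumes s: "- 1 \<le> s" "s \<le> 1 / 2" and t: "0 \<le> t" "t \<le> of_int b ^ 3"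
  shows "line_hits b s (- 1) (- t)"
proof (cases "t \<le> of_int (b ^ 3 - 2 * b)")
  case True
  obtain i j x where *: "0 \<le> i" "i < 2 * b" "0 \<le> j" "of_int (b * j) \<le> t"
    "of_int i \<le> x" "x \<le> of_int i + 1"
    "of_int (b * j + i) \<le> s * x + t" "s * x + t \<le> of_int (b * j + i) + 1"
    using zigzag[OF s t(1), of b] b by auto
  have bj: "b * j \<le> b ^ 3 - 2 * b" using *(4) True by linarith
  then have "b * j \<le> b * b\<^sup>2" using b powers by linarith
  then have "j \<le> b\<^sup>2" using b by simp
  have "(i, b * j + i) \<in> digits b"
    by (rule digitsI[where c = 0 and d = 0 and i = i and j = j and l = 0 and m = 0
          and \<alpha> = "2 * b" and \<beta> = "b\<^sup>2" and \<gamma> = 0 and \<delta> = 0])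
      (use * b bj \<open>j \<le> b\<^sup>2\<close> powers in \<open>auto simp: gap_types_def origins_def intro: add_nonneg_nonneg\<close>)
  then show ?thesis
    using *(5-) by (rule line_hitsI) auto
next
  case False
  then obtain j where j: "of_int j \<le> t" "t \<le> of_int j + 1" "b ^ 3 - 2 * b \<le> j" "j \<le> b ^ 3 - 1"
    using unit_interval_below[of "b ^ 3" "2 * b" t] t by auto
  \<comment> \<open>The fourth type reaches this cell from the top left origin: diagonal steps down,
    then horizontal steps back to abscissa 0.\<close>
  have "(0, j) \<in> digits b"
    by (rule digitsI[where c = 0 and d = "b ^ 3 - 1" and i = "j - (b ^ 3 - 1)" and j = 0 and l = 0
          and m = "(b ^ 3 - 1) - j" and \<alpha> = "2 * b" and \<beta> = 0 and \<gamma> = 0 and \<delta> = "2 * b\<^sup>2"])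
      (use j b powers in \<open>auto simp: gap_types_def origins_def\<close>)
  then show ?thesis
    by (rule line_hitsI[where x = 0 and y = t]) (use j in auto)
qed

text \<open>The argument for the left edge with coordinates exchanged: diagonals of the second type
  start at the multiples of \<open>b\<^sup>2\<close> and have length up to
  \<open>2 * b\<^sup>2\<close>. The right end is filled by a horizontal run of the fourth
  type.\<close>

lemma hits_bottom_edge:
  assumes s: "- 1 \<le> s" "s \<le> 1 / 2" and t: "0 \<le> t" "t \<le> of_int b ^ 3"
  shows "line_hits b (- 1) s (- t)"
proof (cases "t \<le> of_int (b ^ 3 - 2 * b\<^sup>2)")
  case True
  obtain i l y where *: "0 \<le> i" "i < 2 * b\<^sup>2" "0 \<le> l" "of_int (b\<^sup>2 * l) \<le> t"
    "of_int i \<le> y" "y \<le> of_int i + 1"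
    "of_int (b\<^sup>2 * l + i) \<le> s * y + t" "s * y + t \<le> of_int (b\<^sup>2 * l + i) + 1"
    using zigzag[OF s t(1), of "b\<^sup>2"] b by auto
  have bl: "b\<^sup>2 * l \<le> b ^ 3 - 2 * b\<^sup>2" using *(4) True by linarith
  then have "b\<^sup>2 * l \<le> b\<^sup>2 * b" using b powers by (simp add: mult.commute)
  then have "l \<le> b" using b by simp
  have "(b\<^sup>2 * l + i, i) \<in> digits b"
    by (rule digitsI[where c = 0 and d = 0 and i = i and j = 0 and l = l and m = 0
          and \<alpha> = "2 * b\<^sup>2" and \<beta> = 0 and \<gamma> = b and \<delta> = 0])
      (use * b bl \<open>l \<le> b\<close> powers in \<open>auto simp: gap_types_def origins_def intro: add_nonneg_nonneg\<close>)
  then show ?thesis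
    by (rule line_hitsI[where x = "s * y + t" and y = y]) (use *(5-) in auto)
next
  case False
  then obtain j where j: "of_int j \<le> t" "t \<le> of_int j + 1" "b ^ 3 - 2 * b\<^sup>2 \<le> j" "j \<le> b ^ 3 - 1"
    using unit_interval_below[of "b ^ 3" "2 * b\<^sup>2" t] t by auto
  have "(j, 0) \<in> digits b"
    by (rule digitsI[where c = "b ^ 3 - 1" and d = 0 and i = 0 and j = 0 and l = 0
          and m = "j - (b ^ 3 - 1)" and \<alpha> = "2 * b" and \<beta> = 0 and \<gamma> = 0 and \<delta> = "2 * b\<^sup>2"])
      (use j b powers in \<open>auto simp: gap_types_def origins_def\<close>)
  then show ?thesis
    by (rule line_hitsI[where x = t and y = 0]) (use j in auto)
qed

text \<open>From \<open>(x, h)\<close> the line is followed down to the left, into the block of the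
  third type starting at abscissa \<open>b\<^sup>2 * l\<close>. The horizontal segments of the block
  lie at depths \<open>b * j\<close>. As the slope is at least 1/2, the deepest one the line reaches
  there is met within \<open>2 * b\<close> of the left end; slope at most 2 bounds the depth by
  \<open>2 * b\<^sup>2\<close>.\<close>

lemma hits_row:
  assumes s: "1 / 2 \<le> s" "s \<le> 2" and h: "h \<in> {b ^ 3, b ^ 3 div 2}"
    and x: "0 \<le> x" "x \<le> of_int b ^ 3"
  shows "line_hits b s (- 1) (s * x - of_int h)"
proof -
  have "even (b ^ 3)" using b by simp
  then obtain k where k: "b ^ 3 = 2 * k" by (rule evenE)
  have "1 \<le> b\<^sup>2" using b powers by linarith
  then have h_bounds: "2 * b\<^sup>2 + 1 \<le> h" "h \<le> b ^ 3"
    using h powers(3) by (auto simp: k)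
  show ?thesis
  proof (cases "x \<le> of_int (b ^ 3 - 2 * b\<^sup>2)")
    case True
    define l where "l = \<lfloor>x / of_int (b\<^sup>2)\<rfloor>"
    define r where "r = x - of_int (b\<^sup>2) * of_int l"
    have "of_int l \<le> x / of_int (b\<^sup>2)" "x / of_int (b\<^sup>2) < of_int l + 1"
      unfolding l_def by linarith+
    moreover have "(0::real) < of_int (b\<^sup>2)" using b by simp
    ultimately have r: "0 \<le> r" "r < of_int (b\<^sup>2)"
      unfolding r_def by (simp_all add: field_simps del: of_int_power)
    have "0 \<le> l" using x by (simp add: l_def)
    define j where "j = \<lfloor>r * s / of_int b\<rfloor>"
    have b0: "(0::real) < of_int b" using b by simp
    have "of_int j \<le> r * s / of_int b" "r * s / of_int b < of_int j + 1"
      unfolding j_def by linarith+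
    then have j: "of_int (b * j) \<le> r * s" "r * s < of_int (b * j) + of_int b"
      using b0 by (simp_all add: field_simps)
    have "0 \<le> j" using r s b0 by (simp add: j_def)
    \<comment> \<open>The line crosses height \<open>h - b * j\<close> at distance \<open>r'\<close>
      from the left end of the block.\<close>
    define r' where "r' = r - of_int (b * j) / s"
    have s0: "s > 0" using s by simp
    have r'0: "0 \<le> r'" using j s0 by (simp add: r'_def field_simps)
    have "r' * s < of_int b"
      using j s0 by (simp add: r'_def algebra_simps)
    moreover have "r' * (1 / 2) \<le> r' * s" using r'0 s by (intro mult_left_mono)
    ultimately have r'1: "r' < 2 * of_int b" by linarith
    define i where "i = \<lfloor>r'\<rfloor>"
    have i: "of_int i \<le> r'" "r' \<le> of_int i + 1" unfolding i_def by linarith+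
    have "0 \<le> i" using r'0 by (simp add: i_def)
    have "i < 2 * b" using r'1 i by linarith
    have "r * s \<le> of_int (b\<^sup>2) * 2" using r s by (intro mult_mono) auto
    then have bj: "b * j \<le> 2 * b\<^sup>2" using j(1) by linarith
    then have "b * j \<le> b * (2 * b)" by (simp add: power2_eq_square)
    then have "j \<le> 2 * b" using b by simp
    have bl: "b\<^sup>2 * l \<le> b ^ 3 - 2 * b\<^sup>2"
    proof -
      have "of_int (b\<^sup>2 * l) \<le> x" using r by (simp add: r_def)
      then show ?thesis using True by linarith
    qed
    then have "b\<^sup>2 * l \<le> b\<^sup>2 * b" using b powers by (simp add: mult.commute)
    then have "l \<le> b" using b by simp
    have "0 \<le> b\<^sup>2 * l" "0 \<le> b * j" using \<open>0 \<le> l\<close> \<open>0 \<le> j\<close> b by auto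
    then have box: "0 \<le> i + b\<^sup>2 * l" "i + b\<^sup>2 * l < b ^ 3" "0 \<le> h - 1 - b * j" "h - 1 - b * j < b ^ 3"
      using h_bounds bl bj \<open>0 \<le> i\<close> \<open>i < 2 * b\<close> powers(1) b(1) by linarith+
    have mem: "(i + b\<^sup>2 * l, h - 1 - b * j) \<in> digits b"
      by (intro digitsI[where c = 0 and d = "h - 1" and i = 0 and j = "- j" and l = l and m = i
            and \<alpha> = 0 and \<beta> = "2 * b" and \<gamma> = b and \<delta> = "2 * b"])
        (use h b box \<open>0 \<le> i\<close> \<open>i < 2 * b\<close> \<open>0 \<le> l\<close> \<open>l \<le> b\<close> \<open>0 \<le> j\<close> \<open>j \<le> 2 * b\<close>
          in \<open>auto simp: gap_types_def origins_def\<close>)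
    have "s * r' = s * r - of_int (b * j)"
      using s0 by (simp add: r'_def field_simps)
    then show ?thesis
      by (intro line_hitsI[OF mem, where x = "r' + of_int (b\<^sup>2 * l)" and y = "of_int (h - b * j)"])
        (use i in \<open>auto simp: r_def algebra_simps\<close>)
  next
    case False
    then obtain j where j: "of_int j \<le> x" "x \<le> of_int j + 1" "b ^ 3 - 2 * b\<^sup>2 \<le> j" "j \<le> b ^ 3 - 1"
      using unit_interval_below[of "b ^ 3" "2 * b\<^sup>2" x] x by auto
    have "(j, h - 1) \<in> digits b"
      by (rule digitsI[where c = "b ^ 3 - 1" and d = "h - 1" and i = 0 and j = 0 and l = 0
            and m = "j - (b ^ 3 - 1)" and \<alpha> = "2 * b" and \<beta> = 0 and \<gamma> = 0 and \<delta> = "2 * b\<^sup>2"])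
        (use j h h_bounds b powers in \<open>auto simp: gap_types_def origins_def\<close>)
    then show ?thesis
      by (rule line_hitsI[where x = x and y = "of_int h"]) (use j in auto)
  qed
qed

text \<open>A line that misses the left edge crosses the right one and is reflected. Only
  \<open>s\<close> and \<open>t\<close> enter the argument, so the mirror image in the diagonal is
  treated at once.\<close>

lemma hits_graph:
  assumes s: "- 1 \<le> s" "s \<le> 1 / 2"
    and xy: "0 \<le> x" "x \<le> of_int b ^ 3" "0 \<le> y" "y \<le> of_int b ^ 3" and eq: "y = s * x + t"
  shows "line_hits b s (- 1) (- t)" "line_hits b (- 1) s (- t)"
proof -
  define t' where "t' = of_int b ^ 3 - s * of_int b ^ 3 - t"
  have t': "- t' = of_int b ^ 3 * (s + - 1) - - t" "- t' = of_int b ^ 3 * (- 1 + s) - - t"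
    by (simp_all add: t'_def algebra_simps)
  have "(0 \<le> t \<and> t \<le> of_int b ^ 3) \<or> (0 \<le> t' \<and> t' \<le> of_int b ^ 3)"
    unfolding t'_def by (rule slope_cases[OF _ _ xy eq]) (use s in auto)
  then show "line_hits b s (- 1) (- t)" "line_hits b (- 1) s (- t)"
    using hits_left_edge[OF s] hits_bottom_edge[OF s] line_hits_reflect[OF b(2)] t' by metis+
qed

text \<open>Lines through the top edge are caught by the top row, and those through the bottom edge
  are first reflected to the top.\<close>

lemma hits_diagonal:
  assumes s: "1 / 2 \<le> s" "s \<le> 2"
    and xy: "0 \<le> x" "x \<le> of_int b ^ 3" "0 \<le> y" "y \<le> of_int b ^ 3" and eq: "y = s * x + t"
  shows "line_hits b s (- 1) (- t)"
proof -
  define N :: real where "N = of_int b ^ 3"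
  note xy = xy[folded N_def]
  have s0: "s > 0" using s by simp
  have row: "line_hits b s (- 1) (- t')"
    if "h \<in> {b ^ 3, b ^ 3 div 2}" "0 \<le> of_int h - t'" "of_int h - t' \<le> s * N" for h t'
  proof -
    have "0 \<le> (of_int h - t') / s" "(of_int h - t') / s \<le> of_int b ^ 3"
      using that s0 unfolding N_def by (simp_all add: pos_divide_le_eq mult.commute)
    then have "line_hits b s (- 1) (s * ((of_int h - t') / s) - of_int h)"
      by (rule hits_row[OF s that(1)])
    then show ?thesis using s0 by simp
  qed
  have "even (b ^ 3)" using b by simp
  then obtain k where k: "b ^ 3 = 2 * k" by (rule evenE)
  then have half: "N = 2 * of_int k"
    unfolding N_def by (metis of_int_mult of_int_numeral of_int_power)
  have N0: "N \<ge> 0" using xy by linarith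
  have sx: "0 \<le> s * x" "s * x \<le> s * N" "1 / 2 * N \<le> s * N"
    using s0 xy mult_right_mono[OF s(1) N0] by simp_all
  \<comment> \<open>A line that leaves the square neither through its top nor through its bottom runs from left to
    right with slope at least \<open>1/2\<close>, hence crosses the middle row.\<close>
  consider (top) "N - t \<le> s * N" | (bottom) "t \<le> 0" | (mid) "N - t > s * N" "t > 0" by linarith
  then show ?thesis
  proof cases
    case top
    then show ?thesis using row[of "b ^ 3" t] eq xy sx by (simp add: N_def)
  next
    case bottom
    define t' where "t' = N - s * N - t"
    have "line_hits b s (- 1) (- t')"
      using row[of "b ^ 3" t'] bottom eq xy sx by (simp add: N_def t'_def)
    moreover have "- t' = of_int b ^ 3 * (s + - 1) - - t"
      by (simp add: t'_def N_def algebra_simps)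
    ultimately show ?thesis using line_hits_reflect[OF b(2)] by metis
  next
    case mid
    then have "0 \<le> of_int k - t" "of_int k - t \<le> s * N"
      using half sx by linarith+
    then show ?thesis using row[of k t] k by simp
  qed
qed

text \<open>Dividing by the coefficient of larger absolute value makes the line a graph over one of
  the axes with slope in \<open>[-1, 1]\<close>; slopes up to 1/2 are left to the edges, the others
  to the rows.\<close>

lemma digits_block_lines:
  assumes nz: "\<alpha> \<noteq> 0 \<or> \<beta> \<noteq> 0"
    and xy: "0 \<le> x" "x \<le> of_int b ^ 3" "0 \<le> y" "y \<le> of_int b ^ 3" and eq: "\<alpha> * x + \<beta> * y = \<gamma>"
  shows "line_hits b \<alpha> \<beta> \<gamma>"
proof (cases "\<bar>\<alpha>\<bar> \<le> \<bar>\<beta>\<bar>")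
  case True
  then have \<beta>: "\<beta> \<noteq> 0" using nz by auto
  define s where "s = - \<alpha> / \<beta>"
  have "\<bar>s\<bar> \<le> 1" using True \<beta> by (simp add: s_def)
  then have s: "- 1 \<le> s" "s \<le> 1" by auto
  have y: "y = s * x + \<gamma> / \<beta>" using eq \<beta> by (simp add: s_def field_simps)
  have "line_hits b s (- 1) (- (\<gamma> / \<beta>))"
    using hits_graph(1)[OF s(1) _ xy y] hits_diagonal[OF _ _ xy y] s by linarith
  then have "line_hits b (- 1 / \<beta> * \<alpha>) (- 1 / \<beta> * \<beta>) (- 1 / \<beta> * \<gamma>)"
    using \<beta> by (simp add: s_def)
  then show ?thesis
    by (rule line_hits_scale) (use \<beta> in simp)
next
  case False
  then have \<alpha>: "\<alpha> \<noteq> 0" by auto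
  define s where "s = - \<beta> / \<alpha>"
  have "\<bar>s\<bar> \<le> 1" using False \<alpha> by (simp add: s_def)
  then have s: "- 1 \<le> s" "s \<le> 1" by auto
  have x: "x = s * y + \<gamma> / \<alpha>" using eq \<alpha> by (simp add: s_def field_simps)
  show ?thesis
  proof (cases "s \<le> 1 / 2")
    case True
    have "line_hits b (- 1) s (- (\<gamma> / \<alpha>))"
      by (rule hits_graph(2)[OF s(1) True xy(3,4,1,2) x])
    then have "line_hits b (- 1 / \<alpha> * \<alpha>) (- 1 / \<alpha> * \<beta>) (- 1 / \<alpha> * \<gamma>)"
      using \<alpha> by (simp add: s_def)
    then show ?thesis
      by (rule line_hits_scale) (use \<alpha> in simp)
  next
    case False
    then have \<beta>: "\<beta> \<noteq> 0" by (auto simp: s_def)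
    \<comment> \<open>The rows serve graphs over the first axis, so the line is rewritten with slope
      \<open>1 / s\<close>.\<close>
    have inv: "1 / 2 \<le> 1 / s" "1 / s \<le> 2" using False s by (auto simp: field_simps)
    have y: "y = 1 / s * x + \<gamma> / \<beta>"
      using eq \<alpha> \<beta> by (simp add: s_def field_simps)
    have "line_hits b (1 / s) (- 1) (- (\<gamma> / \<beta>))"
      by (rule hits_diagonal[OF inv xy y])
    then have "line_hits b (- 1 / \<beta> * \<alpha>) (- 1 / \<beta> * \<beta>) (- 1 / \<beta> * \<gamma>)"
      using \<alpha> \<beta> by (simp add: s_def)
    then show ?thesis
      by (rule line_hits_scale) (use \<alpha> \<beta> in simp)
  qed
qed

end

subsection \<open>The self-similar set\<close>

definition vec_of :: "int \<times> int \<Rightarrow> real ^ 2" where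
  "vec_of = (\<lambda>(i, j). vector [of_int i, of_int j])"

lemma vec_of_nth [simp]: "vec_of (i, j) $ 1 = of_int i" "vec_of (i, j) $ 2 = of_int j"
  by (simp_all add: vec_of_def)

lemma vec_of_add: "vec_of (p + q) = vec_of p + vec_of q"
  by (cases p; cases q) (simp add: vec_eq_iff forall_2)

lemma inner_vec2: "x \<bullet> y = x $ 1 * y $ 1 + x $ 2 * y $ 2" for x y :: "real ^ 2"
  by (simp add: inner_vec_def sum_2)

lemma mem_unit_square: "x \<in> cbox 0 1 \<longleftrightarrow> 0 \<le> x $ 1 \<and> x $ 1 \<le> 1 \<and> 0 \<le> x $ 2 \<and> x $ 2 \<le> 1"
  for x :: "real ^ 2"
  by (auto simp: mem_box_cart forall_2)

theorem theorem10p1: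
  shows "\<exists>K :: (real ^ 2) set.
    self_similar K \<and> compact K \<and> K \<subseteq> cbox 0 1 \<and>
    (\<forall>L. is_line L \<and> L \<inter> cbox 0 1 \<noteq> {} \<longrightarrow> K \<inter> L \<noteq> {}) \<and>
    nowhere_dense (K + K)"
proof -
  \<comment> \<open>The lower bound gives \<open>1024000 * b ^ 5 < b ^ 6\<close>; evenness is what
    the central reflection needs.\<close>
  obtain b :: int where b: "even b" "b > 1024000"
    by (rule that[of 2000000]) auto
  define N :: real where "N = of_int b ^ 3"
  define r where "r = 1 / N"
  have "1 < (of_int b :: real)" using b by simp
  then have N: "N > 1" unfolding N_def by (intro one_less_power) auto
  then have r: "0 < r" "r < 1" by (simp_all add: r_def)
  define \<phi> where "\<phi> d x = r *\<^sub>R (x + vec_of d)" for d and x :: "real ^ 2"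
  define \<Phi> where "\<Phi> = \<phi> ` digits b"
  \<comment> \<open>All lines, written as hyperplanes: this family is stable under preimages by the
    maps \<open>\<phi> d\<close>.\<close>
  define \<L> where "\<L> = {{x :: real ^ 2. p \<bullet> x = c} | p c. p \<noteq> 0}"
  have fin_\<Phi>: "finite \<Phi>"
    unfolding \<Phi>_def by (intro finite_imageI finite_digits)
  have sim: "is_similarity r (\<phi> d)" for d
    using r by (simp add: is_similarity_def \<phi>_def dist_norm flip: scaleR_diff_right)
  have maps: "continuous_on UNIV f \<and> inj f \<and> f ` cbox 0 1 \<subseteq> cbox 0 1" if f_mem: "f \<in> \<Phi>" for f
  proof (intro conjI)
    obtain d where d: "d \<in> digits b" "f = \<phi> d"
      using f_mem unfolding \<Phi>_def by blast
    obtain i j where "d = (i, j)" by (cases d)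
    then have f: "f = \<phi> (i, j)" and ij: "(i, j) \<in> digits b"
      using d by simp_all
    show "continuous_on UNIV f" unfolding f \<phi>_def by (intro continuous_intros)
    show "inj f" unfolding f \<phi>_def inj_def using r by simp
    have "0 \<le> i" "i + 1 \<le> b ^ 3" "0 \<le> j" "j + 1 \<le> b ^ 3"
      using ij by (auto simp: digits_def)
    then have "0 \<le> real_of_int i" "real_of_int i + 1 \<le> N" "0 \<le> real_of_int j" "real_of_int j + 1 \<le> N"
      unfolding N_def by (simp_all flip: of_int_power add: of_int_le_iff[of "_ + 1", symmetric] del: of_int_le_iff)
    then show "f ` cbox 0 1 \<subseteq> cbox 0 1"
      using N by (auto simp: f \<phi>_def mem_unit_square r_def)
  qed
  have block: "\<exists>f\<in>\<Phi>. f -` L \<in> \<L> \<and> f -` L \<inter> cbox 0 1 \<noteq> {}"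
    if L: "L \<in> \<L>" "L \<inter> cbox 0 1 \<noteq> {}" for L
  proof -
    obtain p c where p: "p \<noteq> 0" and Leq: "L = {x. p \<bullet> x = c}"
      using L(1) by (auto simp: \<L>_def)
    obtain x where x: "x \<in> cbox 0 1" "p \<bullet> x = c"
      using L(2) Leq by auto
    have "p $ 1 \<noteq> 0 \<or> p $ 2 \<noteq> 0" using p by (auto simp: vec_eq_iff forall_2)
    \<comment> \<open>Scaling by \<open>N\<close> moves the unit square to the grid; subtracting the
      corner of the cell hit then gives a point of the pulled-back line in the unit square.\<close>
    then have "line_hits b (p $ 1) (p $ 2) (N * c)"
      by (rule digits_block_lines[where x = "N * x $ 1" and y = "N * x $ 2", rotated 2])
        (use b N x in \<open>auto simp: mem_unit_square inner_vec2 algebra_simps simp flip: N_def\<close>)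
    then obtain i j X Y where ij: "(i, j) \<in> digits b" and
      X: "of_int i \<le> X" "X \<le> of_int i + 1" and Y: "of_int j \<le> Y" "Y \<le> of_int j + 1" and
      XY: "p $ 1 * X + p $ 2 * Y = N * c"
      by (rule line_hitsE)
    have pre: "\<phi> (i, j) -` L = {x. p \<bullet> x = N * c - p \<bullet> vec_of (i, j)}"
      using N by (auto simp: Leq \<phi>_def r_def inner_add_right field_simps)
    have "vector [X - of_int i, Y - of_int j] \<in> \<phi> (i, j) -` L \<inter> cbox 0 1"
      unfolding pre using X Y XY by (simp add: mem_unit_square inner_vec2 algebra_simps)
    moreover have "\<phi> (i, j) -` L \<in> \<L>"
      unfolding pre \<L>_def using p by blast
    ultimately show ?thesis
      using ij unfolding \<Phi>_def by blast
  qed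
  have closed: "closed L" if "L \<in> \<L>" for L
    using that by (auto simp: \<L>_def closed_hyperplane)
  obtain K where K: "compact K" "K \<subseteq> cbox 0 1" "K = (\<Union>f\<in>\<Phi>. f ` K)"
    and K_meets: "\<And>L. L \<in> \<L> \<Longrightarrow> L \<inter> cbox 0 1 \<noteq> {} \<Longrightarrow> L \<inter> K \<noteq> {}"
    using attractor_exists[OF compact_cbox fin_\<Phi> maps closed block] by blast
  \<comment> \<open>One line through the square suffices to show that \<open>K\<close> is
    nonempty.\<close>
  have "0 \<in> {x :: real ^ 2. 1 \<bullet> x = 0} \<inter> cbox 0 1"
    by (simp add: mem_unit_square)
  moreover have "{x :: real ^ 2. 1 \<bullet> x = 0} \<in> \<L>"
    unfolding \<L>_def using one_neq_zero by blast
  ultimately have "K \<noteq> {}"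
    using K_meets by blast
  moreover have "\<forall>f\<in>\<Phi>. \<exists>r. 0 < r \<and> r < 1 \<and> is_similarity r f"
    using sim r unfolding \<Phi>_def by blast
  ultimately have "self_similar K"
    unfolding self_similar_def using K fin_\<Phi> by blast
  moreover have "K \<inter> L \<noteq> {}" if "is_line L" "L \<inter> cbox 0 1 \<noteq> {}" for L
  proof -
    \<comment> \<open>In the plane, dimension 1 is codimension 1, so a line is a hyperplane.\<close>
    have "affine L" "aff_dim L = int DIM(real ^ 2) - 1"
      using that(1) by (simp_all add: is_line_def)
    then obtain p c where "p \<noteq> 0" "L = {x. p \<bullet> x = c}"
      using aff_dim_eq_hyperplane[of L] by (auto simp: hull_same)
    then show ?thesis
      using K_meets[of L] that(2) unfolding \<L>_def by blast
  qed
  moreover have "nowhere_dense (K + K)"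
  proof (rule nowhere_dense_if_few_pieces)
    \<comment> \<open>If \<open>x = \<phi> d x'\<close> and \<open>y = \<phi> e y'\<close>, then
      \<open>x + y\<close> is \<open>x' + y'\<close> scaled by \<open>r\<close> and translated by
      \<open>r *\<^sub>R vec_of (d + e)\<close>, so only sums of digits count.\<close>
    define D where "D = (\<lambda>d. r *\<^sub>R vec_of d) ` (digits b + digits b)"
    show "compact (K + K)"
      unfolding set_plus_image using K(1)
      by (intro compact_continuous_image compact_Times) (auto simp: case_prod_unfold intro!: continuous_intros)
    have fin: "finite (digits b + digits b)" by (intro finite_set_plus finite_digits)
    then show "finite D" by (simp add: D_def)
    show "0 \<le> r" using r by simp
    have "int (card D) \<le> 1024000 * b ^ 5"
      using card_image_le[OF fin, of "\<lambda>d. r *\<^sub>R vec_of d"] card_digits_add_le[of b] b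
      unfolding D_def by linarith
    also have "\<dots> < b * b ^ 5"
      using b by (intro mult_strict_right_mono) auto
    also have "\<dots> = (b ^ 3)\<^sup>2" by (simp add: eval_nat_numeral)
    finally have "of_int (int (card D)) < (of_int ((b ^ 3)\<^sup>2) :: real)"
      unfolding of_int_less_iff .
    then have "real (card D) < N\<^sup>2" by (simp add: N_def)
    then show "real (card D) * r ^ DIM(real ^ 2) < 1"
      using N by (simp add: r_def power_divide)
    show "K + K \<subseteq> (\<Union>d\<in>D. (\<lambda>x. r *\<^sub>R x + d) ` (K + K))"
    proof
      fix z assume "z \<in> K + K"
      then obtain x y where "x \<in> K" "y \<in> K" and z: "z = x + y"
        by (rule set_plus_elim)
      then obtain d e x' y' where d: "d \<in> digits b" "e \<in> digits b" and xy': "x' \<in> K" "y' \<in> K"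
        and "x = \<phi> d x'" "y = \<phi> e y'"
        using K(3) unfolding \<Phi>_def by blast
      then have "z = r *\<^sub>R (x' + y') + r *\<^sub>R vec_of (d + e)"
        by (simp add: z \<phi>_def vec_of_add algebra_simps)
      moreover have "r *\<^sub>R vec_of (d + e) \<in> D" "x' + y' \<in> K + K"
        unfolding D_def using d xy' by (auto intro: set_plus_intro)
      ultimately show "z \<in> (\<Union>d\<in>D. (\<lambda>x. r *\<^sub>R x + d) ` (K + K))"
        by blast
    qed
  qed
  ultimately show ?thesis
    using K by blast
qed

end
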